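(* Let $\mathbb{F}$ be a field. Let $\mathbf{ax+b}_{\mathbb{F}}$ be the 2-dimensional Lie algebra with basis $e_0,e_1$ and $[e_0,e_1]=e_1$, and let $\mathbf{H}_{\mathbb{F}}$ be the Heisenberg algebra. Written as matrices acting on column coordinates, in the ordered basis $(e_1,e_0)$ for $\mathbf{ax+b}_{\mathbb{F}}$ and $(e_1,e_2,e_0)$ for $\mathbf{H}_{\mathbb{F}}$, the Lie orthogonal operators of these algebras are $$\mathrm{LO}(\mathbf{ax+b}_{\mathbb{F}})=\mathrm{SL}(2,\mathbb{F}),$$ $$\mathrm{LO}(\mathbf{H}_{\mathbb{F}})=\left\{\begin{pmatrix}\Delta_{11}&\Delta_{12}&\gamma_1\\ 0&\Delta_{22}&\gamma_2\\ 0&\beta_2&\alpha\end{pmatrix}\;\middle|\;\alpha,\beta_2,\gamma_1,\gamma_2,\Delta_{11},\Delta_{12},\Delta_{22}\in\mathbb{F},\ \alpha\Delta_{22}-\gamma_2\beta_2=1\right\}.$$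
   Context: A linear operator $T\in\mathrm{End}_{\mathbb{F}}(\mathbf{L})$ on a Lie algebra $\mathbf{L}$ is called Lie orthogonal if $[TX,TY]=[X,Y]$ for all $X,Y\in\mathbf{L}$ (no invertibility is assumed); $\mathrm{LO}(\mathbf{L})$ is the set of all Lie orthogonal operators. $\mathbf{H}_{\mathbb{F}}$ is the 3-dimensional Lie algebra with basis $e_0,e_1,e_2$ and $[e_0,e_2]=e_1$, $[e_0,e_1]=[e_1,e_2]=0$. $\mathrm{SL}(2,\mathbb{F})$ is the group of $2\times2$ matrices over $\mathbb{F}$ of determinant 1. *)

theory Defs
  imports "HOL-Analysis.Analysis"
begin

locale lie_algebra = vector_space scale
  for scale :: "'f::field \<Rightarrow> 'v::ab_group_add \<Rightarrow> 'v" +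
  fixes bracket :: "'v \<Rightarrow> 'v \<Rightarrow> 'v"
  assumes bracket_linear_left: "Vector_Spaces.linear scale scale (\<lambda>x. bracket x y)"
    and bracket_linear_right: "Vector_Spaces.linear scale scale (\<lambda>y. bracket x y)"
    and bracket_self: "bracket x x = 0"
    and jacobi: "bracket x (bracket y z) + bracket y (bracket z x) + bracket z (bracket x y) = 0"

definition (in lie_algebra) LO :: "('v \<Rightarrow> 'v) set" where
  "LO = {T. Vector_Spaces.linear scale scale T \<and> (\<forall>x y. bracket (T x) (T y) = bracket x y)}"

locale ax_plus_b = lie_algebra scale bracket
  for scale :: "'f::field \<Rightarrow> 'v::ab_group_add \<Rightarrow> 'v" and bracket +
  fixes e0 e1 :: 'v
  assumes distinct_basis: "distinct [e0, e1]"
    and independent_basis: "independent {e0, e1}"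
    and span_basis: "span {e0, e1} = UNIV"
    and bracket_e0_e1: "bracket e0 e1 = e1"

locale heisenberg = lie_algebra scale bracket
  for scale :: "'f::field \<Rightarrow> 'v::ab_group_add \<Rightarrow> 'v" and bracket +
  fixes e0 e1 e2 :: 'v
  assumes distinct_basis: "distinct [e0, e1, e2]"
    and independent_basis: "independent {e0, e1, e2}"
    and span_basis: "span {e0, e1, e2} = UNIV"
    and bracket_e0_e2: "bracket e0 e2 = e1"
    and bracket_e0_e1: "bracket e0 e1 = 0"
    and bracket_e1_e2: "bracket e1 e2 = 0"

text \<open>The ordered basis is given as a vector \<open>B\<close> of vectors. Column \<open>j\<close> of the matrix
  holds the coordinates of \<open>T (B $ j)\<close>, so the matrix acts on column
  coordinates. It is meaningful only if the entries of \<open>B\<close> are distinct and form a basis.\<close>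

definition matrix_wrt ::
  "('f::field \<Rightarrow> 'v::ab_group_add \<Rightarrow> 'v) \<Rightarrow> 'v ^ 'n \<Rightarrow> ('v \<Rightarrow> 'v) \<Rightarrow> 'f ^ 'n ^ 'n" where
  "matrix_wrt s B T =
     (\<chi> i j. module.representation s (range (($) B)) (T (B $ j)) (B $ i))"

definition SL2 :: "('f::field ^ 2 ^ 2) set" where
  "SL2 = {A. det A = 1}"

text \<open>Both locales have a model over every field.\<close>

lemma ax_plus_b_model:
  "ax_plus_b (*s) (\<lambda>x y :: 'f::field ^ 2. vector [x $ 2 * y $ 1 - x $ 1 * y $ 2, 0])
     (vector [0, 1]) (vector [1, 0])"
proof -
  let ?e0 = "vector [0, 1] :: 'f ^ 2" and ?e1 = "vector [1, 0] :: 'f ^ 2"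
  have basis: "{?e0, ?e1} = cart_basis"
  proof -
    have "?e0 = axis 2 1" "?e1 = axis 1 1"
      by (simp_all add: vec_eq_iff forall_2 axis_def)
    then show ?thesis
      by (auto simp: cart_basis_def) (metis exhaust_2)
  qed
  show ?thesis
    by unfold_locales (simp_all add: basis independent_cart_basis vec_eq_iff forall_2 algebra_simps)
qed

lemma heisenberg_model:
  "heisenberg (*s) (\<lambda>x y :: 'f::field ^ 3. vector [x $ 3 * y $ 2 - x $ 2 * y $ 3, 0, 0])
     (vector [0, 0, 1]) (vector [1, 0, 0]) (vector [0, 1, 0])"
proof -
  let ?e0 = "vector [0, 0, 1] :: 'f ^ 3" and ?e1 = "vector [1, 0, 0] :: 'f ^ 3"
    and ?e2 = "vector [0, 1, 0] :: 'f ^ 3"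
  have basis: "{?e0, ?e1, ?e2} = cart_basis"
  proof -
    have "?e0 = axis 3 1" "?e1 = axis 1 1" "?e2 = axis 2 1"
      by (simp_all add: vec_eq_iff forall_3 axis_def)
    then show ?thesis
      by (auto simp: cart_basis_def) (metis exhaust_3)
  qed
  show ?thesis
    by unfold_locales (simp_all add: basis independent_cart_basis vec_eq_iff forall_3 algebra_simps)
qed

end

theory Submission
  imports Defs
begin

text \<open>In both algebras the derived algebra is the line through one vector \<open>z\<close>, so the bracket
  has the form \<open>[x, y] = \<omega>(x, y) z\<close> for an alternating bilinear form \<open>\<omega>\<close>. An operator is
  therefore Lie orthogonal exactly when it is an isometry of \<open>\<omega>\<close>. In coordinates, with \<open>\<Omega>\<close>
  the Gram matrix of \<open>\<omega>\<close>, this is the equation \<open>M\<^sup>T \<Omega> M = \<Omega>\<close>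
  (lemma \<open>matrix_wrt_LO\<close>), and what is left is to solve it twice.

  For the algebra of the affine group \<open>\<omega>\<close> is a nondegenerate form on a plane, where
  \<open>M\<^sup>T \<Omega> M = (det M) \<Omega>\<close>; hence the special linear group. For the Heisenberg algebra the
  radical of \<open>\<omega>\<close> is the centre, spanned by \<open>e1\<close>. Modulo the centre \<open>\<omega>\<close> is again a
  nondegenerate form on a plane, so the induced block has determinant 1. This block is then
  invertible, which forces \<open>M\<close> to preserve the radical, while nothing restricts the first row
  of \<open>M\<close>, which \<open>\<omega>\<close> does not see.\<close>

section \<open>Operators and matrices with respect to an ordered basis\<close>

lemma (in vector_space) sum_representation_indexed_basis:
  fixes B :: "'b ^ 'n"
  assumes inj: "inj (($) B)" and indep: "independent (range (($) B))"
    and span: "span (range (($) B)) = UNIV"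
  shows "(\<Sum>i\<in>UNIV. scale (representation (range (($) B)) v (B $ i)) (B $ i)) = v"
proof -
  have "(\<Sum>b\<in>range (($) B). scale (representation (range (($) B)) v b) b) = v"
    by (rule sum_representation_eq[OF indep]) (auto simp: span)
  then show ?thesis
    by (simp add: sum.reindex[OF inj])
qed

lemma (in vector_space) representation_indexed_sum:
  fixes B :: "'b ^ 'n"
  assumes inj: "inj (($) B)" and indep: "independent (range (($) B))"
    and span: "span (range (($) B)) = UNIV"
  shows "representation (range (($) B)) (\<Sum>k\<in>UNIV. scale (c k) (B $ k)) (B $ i) = c i"
  by (simp add: representation_sum[OF indep] representation_scale[OF indep]
      representation_basis[OF indep] span inj_eq[OF inj] if_distrib if_distribR cong: if_cong)

lemma (in vector_space) exists_linear_matrix_wrt: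
  fixes B :: "'b ^ 'n" and M :: "'a ^ 'n ^ 'n"
  assumes inj: "inj (($) B)" and indep: "independent (range (($) B))"
    and span: "span (range (($) B)) = UNIV"
  obtains T where "Vector_Spaces.linear scale scale T" "matrix_wrt scale B T = M"
proof -
  interpret vector_space_pair scale scale ..
  obtain T where T: "Vector_Spaces.linear scale scale T"
    and TB: "\<forall>x\<in>range (($) B). T x = (\<Sum>k\<in>UNIV. scale (M $ k $ inv (($) B) x) (B $ k))"
    using linear_independent_extend[OF indep,
        of "\<lambda>x. \<Sum>k\<in>UNIV. scale (M $ k $ inv (($) B) x) (B $ k)"] by auto
  have "T (B $ j) = (\<Sum>k\<in>UNIV. scale (M $ k $ j) (B $ k))" for j
    using TB inj by simp
  then have "matrix_wrt scale B T = M"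
    by (simp add: matrix_wrt_def vec_eq_iff representation_indexed_sum[OF assms])
  with T show thesis by (rule that)
qed

section \<open>Lie orthogonality as an isometry condition\<close>

context lie_algebra
begin

lemma bracket_sum_sum:
  "bracket (\<Sum>i\<in>I. scale (a i) (x i)) (\<Sum>j\<in>J. scale (b j) (y j))
    = (\<Sum>i\<in>I. \<Sum>j\<in>J. scale (a i * b j) (bracket (x i) (y j)))"
proof -
  have left: "module_hom scale scale (\<lambda>x. bracket x y)" for y
    using bracket_linear_left by (simp add: linear_iff_module_hom)
  have right: "module_hom scale scale (\<lambda>y. bracket x y)" for x
    using bracket_linear_right by (simp add: linear_iff_module_hom)
  show ?thesis
    by (simp add: module_hom.sum[OF left] module_hom.scale[OF left] module_hom.sum[OF right]
        module_hom.scale[OF right] scale_sum_right mult.commute sum.swap[of _ J I])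
qed

lemma bracket_anticommute: "bracket y x = - bracket x y"
proof -
  interpret left: Vector_Spaces.linear scale scale "\<lambda>u. bracket u v" for v
    by (rule bracket_linear_left)
  interpret right: Vector_Spaces.linear scale scale "\<lambda>u. bracket v u" for v
    by (rule bracket_linear_right)
  have "bracket x y + bracket y x = bracket (x + y) (x + y)"
    unfolding left.add right.add by (simp add: bracket_self)
  also have "\<dots> = 0"
    by (rule bracket_self)
  finally show ?thesis
    by (simp add: eq_neg_iff_add_eq_0 add.commute)
qed

text \<open>The matrix \<open>\<Omega>\<close> is the Gram matrix of the bracket, regarded as a scalar form by means of
  \<open>z\<close>; since \<open>z \<noteq> 0\<close>, comparing brackets amounts to comparing scalars. Bilinearity reduces
  Lie orthogonality to pairs of basis vectors, where it is an equation between matrix entries.\<close>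

lemma matrix_wrt_LO:
  fixes B :: "'v ^ 'n" and \<Omega> :: "'f ^ 'n ^ 'n"
  assumes inj: "inj (($) B)" and indep: "independent (range (($) B))"
    and span: "span (range (($) B)) = UNIV"
    and gram: "\<And>i j. bracket (B $ i) (B $ j) = scale (\<Omega> $ i $ j) z" and z: "z \<noteq> 0"
  shows "matrix_wrt scale B ` LO = {M. transpose M ** \<Omega> ** M = \<Omega>}"
proof -
  let ?rep = "\<lambda>v k. representation (range (($) B)) v (B $ k)"
  note expand = sum_representation_indexed_basis[OF inj indep span]
  have form: "bracket x y = scale (\<Sum>k\<in>UNIV. \<Sum>l\<in>UNIV. ?rep x k * ?rep y l * \<Omega> $ k $ l) z" for x y
    using bracket_sum_sum[of "?rep x" "($) B" UNIV "?rep y" "($) B" UNIV]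
    by (simp add: expand gram scale_sum_left)
  have pullback: "(transpose M ** \<Omega> ** M) $ i $ j
      = (\<Sum>k\<in>UNIV. \<Sum>l\<in>UNIV. M $ k $ i * M $ l $ j * \<Omega> $ k $ l)" for M :: "'f ^ 'n ^ 'n" and i j
  proof -
    have "(transpose M ** \<Omega> ** M) $ i $ j
        = (\<Sum>l\<in>UNIV. \<Sum>k\<in>UNIV. M $ k $ i * \<Omega> $ k $ l * M $ l $ j)"
      by (simp add: matrix_matrix_mult_def transpose_def sum_distrib_right)
    also have "\<dots> = (\<Sum>k\<in>UNIV. \<Sum>l\<in>UNIV. M $ k $ i * M $ l $ j * \<Omega> $ k $ l)"
      by (subst sum.swap) (simp add: mult.commute mult.left_commute)
    finally show ?thesis .
  qed
  have basis_pair: "bracket (T (B $ i)) (T (B $ j)) = bracket (B $ i) (B $ j)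
      \<longleftrightarrow> (transpose (matrix_wrt scale B T) ** \<Omega> ** matrix_wrt scale B T) $ i $ j = \<Omega> $ i $ j"
    for T i j
    using z by (simp add: form[of "T (B $ i)"] gram pullback matrix_wrt_def)
  have LO_iff: "T \<in> LO \<longleftrightarrow>
      transpose (matrix_wrt scale B T) ** \<Omega> ** matrix_wrt scale B T = \<Omega>"
    if T: "Vector_Spaces.linear scale scale T" for T
  proof
    assume "T \<in> LO"
    then show "transpose (matrix_wrt scale B T) ** \<Omega> ** matrix_wrt scale B T = \<Omega>"
      by (simp add: LO_def vec_eq_iff[of _ \<Omega>] vec_eq_iff[of _ "\<Omega> $ _"] flip: basis_pair)
  next
    assume "transpose (matrix_wrt scale B T) ** \<Omega> ** matrix_wrt scale B T = \<Omega>"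
    then have basis: "bracket (T (B $ i)) (T (B $ j)) = bracket (B $ i) (B $ j)" for i j
      by (simp add: basis_pair)
    have T_hom: "module_hom scale scale T"
      using T by (simp add: linear_iff_module_hom)
    have T_expand: "T x = (\<Sum>k\<in>UNIV. scale (?rep x k) (T (B $ k)))" for x
      using arg_cong[OF expand[of x], of T]
      by (simp add: module_hom.sum[OF T_hom] module_hom.scale[OF T_hom])
    have "bracket (T x) (T y) = bracket x y" for x y
    proof -
      have "bracket (T x) (T y)
          = (\<Sum>k\<in>UNIV. \<Sum>l\<in>UNIV. scale (?rep x k * ?rep y l) (bracket (B $ k) (B $ l)))"
        by (simp add: T_expand[of x] T_expand[of y] bracket_sum_sum basis)
      also have "\<dots> = bracket x y"
        by (simp add: form[of x y] gram scale_sum_left)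
      finally show ?thesis .
    qed
    with T show "T \<in> LO" by (simp add: LO_def)
  qed
  show ?thesis
  proof (intro equalityI subsetI)
    fix M assume "M \<in> matrix_wrt scale B ` LO"
    then show "M \<in> {M. transpose M ** \<Omega> ** M = \<Omega>}"
      using LO_iff by (auto simp: LO_def)
  next
    fix M assume M: "M \<in> {M. transpose M ** \<Omega> ** M = \<Omega>}"
    obtain T where "Vector_Spaces.linear scale scale T" "matrix_wrt scale B T = M"
      using exists_linear_matrix_wrt[OF inj indep span] .
    with M show "M \<in> matrix_wrt scale B ` LO"
      using LO_iff by blast
  qed
qed

end

section \<open>Isometries of the two alternating forms\<close>

lemma isometry_symplectic_2:
  fixes M :: "'f::field ^ 2 ^ 2"
  defines "\<Omega> \<equiv> vector [vector [0, -1], vector [1, 0]]"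
  shows "transpose M ** \<Omega> ** M = \<Omega> \<longleftrightarrow> det M = 1"
proof -
  have "transpose M ** \<Omega> ** M = vector [vector [0, - det M], vector [det M, 0]]"
    by (simp add: \<Omega>_def matrix_matrix_mult_def transpose_def vec_eq_iff forall_2 sum_2 det_2)
  then show ?thesis
    by (auto simp: \<Omega>_def vec_eq_iff forall_2)
qed

text \<open>Off the first row and column, the equation says that the lower right block has
  determinant 1. The first row and column say that the vector of entries below the corner is
  orthogonal, for the symplectic form of the plane, to the two columns of that block; these
  columns span the plane, so the vector vanishes.\<close>

lemma isometry_symplectic_radical_3:
  fixes M :: "'f::field ^ 3 ^ 3"
  defines "\<Omega> \<equiv> vector [vector [0, 0, 0], vector [0, 0, -1], vector [0, 1, 0]]"
  shows "transpose M ** \<Omega> ** M = \<Omega> \<longleftrightarrow>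
    M $ 2 $ 1 = 0 \<and> M $ 3 $ 1 = 0 \<and> M $ 3 $ 3 * M $ 2 $ 2 - M $ 2 $ 3 * M $ 3 $ 2 = 1"
    (is "?isometry \<longleftrightarrow> ?p = 0 \<and> ?q = 0 \<and> ?det = 1")
proof -
  let ?a = "?q * M $ 2 $ 2 - ?p * M $ 3 $ 2" and ?b = "?q * M $ 2 $ 3 - ?p * M $ 3 $ 3"
  have "transpose M ** \<Omega> ** M
      = vector [vector [0, ?a, ?b], vector [- ?a, 0, - ?det], vector [- ?b, ?det, 0]]"
    by (simp add: \<Omega>_def matrix_matrix_mult_def transpose_def vec_eq_iff forall_3 sum_3
        mult.commute)
  moreover have "vector [vector [0, a, b], vector [- a, 0, - d], vector [- b, d, 0]] = \<Omega>
      \<longleftrightarrow> a = 0 \<and> b = 0 \<and> d = 1" for a b d :: 'f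
    by (auto simp: \<Omega>_def vec_eq_iff forall_3)
  ultimately have "?isometry \<longleftrightarrow> ?a = 0 \<and> ?b = 0 \<and> ?det = 1"
    by (simp only:)
  moreover have "?p = 0 \<and> ?q = 0" if "?a = 0" "?b = 0" "?det = 1"
  proof -
    \<comment> \<open>Cramer's rule for the homogeneous system \<open>?a = ?b = 0\<close> in the unknowns \<open>?p\<close> and \<open>?q\<close>.\<close>
    have "?p * ?det = M $ 2 $ 3 * ?a - M $ 2 $ 2 * ?b"
      "?q * ?det = M $ 3 $ 3 * ?a - M $ 3 $ 2 * ?b"
      by (simp_all add: algebra_simps)
    then show ?thesis
      unfolding that by simp
  qed
  ultimately show ?thesis by auto
qed

section \<open>The two algebras\<close>

lemma range_nth_vector_2: "range (($) (vector [x, y] :: 'a::zero ^ 2)) = {x, y}"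
  by (auto simp: UNIV_2)

lemma range_nth_vector_3: "range (($) (vector [x, y, z] :: 'a::zero ^ 3)) = {x, y, z}"
  by (auto simp: UNIV_3)

lemma (in ax_plus_b) matrix_wrt_LO_ax_plus_b:
  "matrix_wrt scale (vector [e1, e0] :: 'v ^ 2) ` LO = SL2"
proof -
  let ?B = "vector [e1, e0] :: 'v ^ 2"
  have range: "range (($) ?B) = {e0, e1}"
    by (auto simp: range_nth_vector_2)
  have "inj (($) ?B)"
    using distinct_basis by (auto simp: inj_def forall_2)
  moreover have "e1 \<noteq> 0"
    using independent_basis dependent_zero[of "{e0, e1}"] by auto
  moreover have "bracket (?B $ i) (?B $ j)
      = scale ((vector [vector [0, -1], vector [1, 0]] :: 'f ^ 2 ^ 2) $ i $ j) e1" for i j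
  proof -
    have "bracket e1 e0 = - e1"
      using bracket_anticommute[of e1 e0] bracket_e0_e1 by simp
    then show ?thesis
      using exhaust_2[of i] exhaust_2[of j] by (auto simp: bracket_self bracket_e0_e1)
  qed
  ultimately have "matrix_wrt scale ?B ` LO
      = {M. transpose M ** vector [vector [0, -1], vector [1, 0]] ** M
          = vector [vector [0, -1], vector [1, 0]]}"
    by (intro matrix_wrt_LO) (simp_all only: range independent_basis span_basis not_False_eq_True)
  then show ?thesis
    by (simp add: isometry_symplectic_2 SL2_def)
qed

lemma (in heisenberg) matrix_wrt_LO_heisenberg:
  "matrix_wrt scale (vector [e1, e2, e0] :: 'v ^ 3) ` LO =
    {M. M $ 2 $ 1 = 0 \<and> M $ 3 $ 1 = 0 \<and> M $ 3 $ 3 * M $ 2 $ 2 - M $ 2 $ 3 * M $ 3 $ 2 = 1}"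
proof -
  let ?B = "vector [e1, e2, e0] :: 'v ^ 3"
  have range: "range (($) ?B) = {e0, e1, e2}"
    by (auto simp: range_nth_vector_3)
  have "inj (($) ?B)"
    using distinct_basis by (auto simp: inj_def forall_3)
  moreover have "e1 \<noteq> 0"
    using independent_basis dependent_zero[of "{e0, e1, e2}"] by auto
  moreover have "bracket (?B $ i) (?B $ j)
      = scale ((vector [vector [0, 0, 0], vector [0, 0, -1], vector [0, 1, 0]] :: 'f ^ 3 ^ 3)
          $ i $ j) e1" for i j
  proof -
    have "bracket e2 e0 = - e1" "bracket e1 e0 = 0" "bracket e2 e1 = 0"
      using bracket_anticommute[of e2 e0] bracket_anticommute[of e1 e0]
        bracket_anticommute[of e2 e1] bracket_e0_e2 bracket_e0_e1 bracket_e1_e2 by simp_all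
    then show ?thesis
      using exhaust_3[of i] exhaust_3[of j]
      by (auto simp: bracket_self bracket_e0_e2 bracket_e0_e1 bracket_e1_e2)
  qed
  ultimately have "matrix_wrt scale ?B ` LO
      = {M. transpose M ** vector [vector [0, 0, 0], vector [0, 0, -1], vector [0, 1, 0]] ** M
          = vector [vector [0, 0, 0], vector [0, 0, -1], vector [0, 1, 0]]}"
    by (intro matrix_wrt_LO) (simp_all only: range independent_basis span_basis not_False_eq_True)
  then show ?thesis
    by (simp add: isometry_symplectic_radical_3)
qed

theorem proposition14:
  fixes scaleA :: "'f::field \<Rightarrow> 'a::ab_group_add \<Rightarrow> 'a"
    and bracketA :: "'a \<Rightarrow> 'a \<Rightarrow> 'a"
    and a0 a1 :: 'a
    and scaleH :: "'f \<Rightarrow> 'h::ab_group_add \<Rightarrow> 'h"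
    and bracketH :: "'h \<Rightarrow> 'h \<Rightarrow> 'h"
    and h0 h1 h2 :: 'h
  assumes "ax_plus_b scaleA bracketA a0 a1"
    and "heisenberg scaleH bracketH h0 h1 h2"
  shows "matrix_wrt scaleA (vector [a1, a0] :: 'a ^ 2) ` lie_algebra.LO scaleA bracketA = SL2
    \<and> matrix_wrt scaleH (vector [h1, h2, h0] :: 'h ^ 3) ` lie_algebra.LO scaleH bracketH =
      {vector [vector [\<Delta>11, \<Delta>12, \<gamma>1],
               vector [0, \<Delta>22, \<gamma>2],
               vector [0, \<beta>2, \<alpha>]]
       | \<alpha> \<beta>2 \<gamma>1 \<gamma>2 \<Delta>11 \<Delta>12 \<Delta>22. \<alpha> * \<Delta>22 - \<gamma>2 * \<beta>2 = 1}"
proof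
  show "matrix_wrt scaleA (vector [a1, a0] :: 'a ^ 2) ` lie_algebra.LO scaleA bracketA = SL2"
    using assms(1) by (rule ax_plus_b.matrix_wrt_LO_ax_plus_b)
next
  have "{M :: 'f ^ 3 ^ 3. M $ 2 $ 1 = 0 \<and> M $ 3 $ 1 = 0
        \<and> M $ 3 $ 3 * M $ 2 $ 2 - M $ 2 $ 3 * M $ 3 $ 2 = 1}
      = {vector [vector [\<Delta>11, \<Delta>12, \<gamma>1], vector [0, \<Delta>22, \<gamma>2], vector [0, \<beta>2, \<alpha>]]
         | \<alpha> \<beta>2 \<gamma>1 \<gamma>2 \<Delta>11 \<Delta>12 \<Delta>22. \<alpha> * \<Delta>22 - \<gamma>2 * \<beta>2 = 1}" (is "?L = ?R")
  proof (intro equalityI subsetI)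
    fix M assume M: "M \<in> ?L"
    then have "M = vector [vector [M $ 1 $ 1, M $ 1 $ 2, M $ 1 $ 3],
        vector [0, M $ 2 $ 2, M $ 2 $ 3], vector [0, M $ 3 $ 2, M $ 3 $ 3]]"
      by (simp add: vec_eq_iff forall_3)
    with M show "M \<in> ?R" by blast
  next
    fix M assume "M \<in> ?R"
    then show "M \<in> ?L" by auto
  qed
  then show "matrix_wrt scaleH (vector [h1, h2, h0] :: 'h ^ 3) ` lie_algebra.LO scaleH bracketH =
      {vector [vector [\<Delta>11, \<Delta>12, \<gamma>1],
               vector [0, \<Delta>22, \<gamma>2],
               vector [0, \<beta>2, \<alpha>]]
       | \<alpha> \<beta>2 \<gamma>1 \<gamma>2 \<Delta>11 \<Delta>12 \<Delta>22. \<alpha> * \<Delta>22 - \<gamma>2 * \<beta>2 = 1}"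
    using heisenberg.matrix_wrt_LO_heisenberg[OF assms(2)] by simp
qed

end
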